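(* For an infinite real matrix $A=(a_{nk})_{n,k\in\mathbb{N}}$ and $m,n,k\in\mathbb{N}$ put $d_{mk}^{(n)}=\sum_{j=k}^{m}\frac{f_{j+1}^{2}}{f_{k}f_{k+1}}a_{nj}$ if $0\le k\le m$ and $d_{mk}^{(n)}=0$ if $k>m$. Consider the following conditions on $A$: (C1) $\sup_{m\in\mathbb{N}}\sum_{k=0}^{m}|d_{mk}^{(n)}|<\infty$ for each $n\in\mathbb{N}$; (C2) the limit $d_{nk}:=\lim_{m\to\infty}d_{mk}^{(n)}$ exists (and is finite) for each $k,n\in\mathbb{N}$; (C3) $\sup_{n\in\mathbb{N}}\sum_{k=0}^\infty|d_{nk}|<\infty$; (C4) the limit $\alpha_k:=\lim_{n\to\infty}d_{nk}$ exists (and is finite) for each $k\in\mathbb{N}$; (C5) $\sup_{N,K\in\mathcal{F}}\big|\sum_{n\in N}\sum_{k\in K}d_{nk}\big|<\infty$; where in (C3)-(C5) $d_{nk}$ is the limit from (C2). Let $A=(a_{nk})$ be an infinite real matrix, let $A^{\Sigma}=(a(n,k))_{n,k}$ with $a(n,k)=\sum_{j=0}^{n}a_{jk}$, and let $A^{\Delta}=(a_{nk}-a_{n-1,k})_{n,k}$ with $a_{-1,k}:=0$. Then: (a) $A\in(c_{0}(\widehat{F}),c_{0})$ if and only if $A$ satisfies (C1), (C2), (C3), and (C4) with $\alpha_{k}=0$ for all $k\in\mathbb{N}$. (b) $A\in(c_{0}(\widehat{F}),cs_{0})$ if and only if $A^{\Sigma}$ satisfies (C1), (C2), (C3), and (C4)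 with $\alpha_{k}=0$ for all $k\in\mathbb{N}$. (c) $A\in(c_{0}(\widehat{F}),c)$ if and only if $A$ satisfies (C1), (C2), (C3) and (C4). (d) $A\in(c_{0}(\widehat{F}),cs)$ if and only if $A^{\Sigma}$ satisfies (C1), (C2), (C3) and (C4). (e) $A\in(c_{0}(\widehat{F}),\ell_{\infty})$ if and only if $A$ satisfies (C1), (C2) and (C3). (f) $A\in(c_{0}(\widehat{F}),bs)$ if and only if $A^{\Sigma}$ satisfies (C1), (C2) and (C3). (g) $A\in(c_{0}(\widehat{F}),\ell_{1})$ if and only if $A$ satisfies (C1), (C2) and (C5). (h) $A\in(c_{0}(\widehat{F}),bv_{1})$ if and only if $A^{\Delta}$ satisfies (C1), (C2) and (C5).
   Context: Let $\mathbb{N}=\{0,1,2,\dots\}$, let $\mathcal{F}$ be the collection of all finite subsets of $\mathbb{N}$, and let $\omega$ be the vector space of all real sequences $x=(x_k)_{k\in\mathbb{N}}$. The Fibonacci numbers are defined by $f_0=f_1=1$ and $f_n=f_{n-1}+f_{n-2}$ for $n\ge 2$. For $x\in\omega$ the $\widehat{F}$-transform $\widehat{F}x=(\widehat{F}_n(x))_{n\in\mathbb{N}}$ is defined by $\widehat{F}_0(x)=x_0$ and $\widehat{F}_n(x)=\frac{f_n}{f_{n+1}}x_n-\frac{f_{n+1}}{f_n}x_{n-1}$ for $n\ge1$. Let $c_0$, $c$, $\ell_\infty$, $\ell_1$ be the spaces of null, convergent, bounded and absolutely summable sequences, and put $c_0(\widehat{F})=\{x\in\omega:\widehat{F}x\in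 c_0\}$. Let $bs$, $cs$, $cs_0$ be the spaces of sequences $x\in\omega$ whose sequence of partial sums $\big(\sum_{k=0}^n x_k\big)_n$ is bounded, convergent, convergent to $0$, respectively, and $bv_1=\{x\in\omega:\sum_{k}|x_k-x_{k-1}|<\infty\}$ with $x_{-1}:=0$. For $\lambda,\mu\subseteq\omega$, $(\lambda,\mu)$ denotes the class of all infinite real matrices $A=(a_{nk})$ such that for every $x\in\lambda$ the series $A_n(x)=\sum_{k=0}^\infty a_{nk}x_k$ converges for each $n\in\mathbb{N}$ and the sequence $Ax=(A_n(x))_{n\in\mathbb{N}}$ belongs to $\mu$. *)

theory Defs
  imports "HOL-Analysis.Analysis" "HOL-Number_Theory.Fib"
begin

(* The library's fib starts with fib 0 = 0, fib 1 = 1; here the convention is f_0 = f_1 = 1. *)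
definition fibo :: "nat \<Rightarrow> real" where
  "fibo n = real (fib (Suc n))"

lemma fibo_0: "fibo 0 = 1" and fibo_1: "fibo 1 = 1"
  by (simp_all add: fibo_def)

lemma fibo_rec: "n \<ge> 2 \<Longrightarrow> fibo n = fibo (n - 1) + fibo (n - 2)"
  by (cases n rule: fib.cases) (simp_all add: fibo_def)

definition F_hat :: "(nat \<Rightarrow> real) \<Rightarrow> nat \<Rightarrow> real" where
  "F_hat x n = (if n = 0 then x 0 else fibo n / fibo (n + 1) * x n - fibo (n + 1) / fibo n * x (n - 1))"

definition c0_space :: "(nat \<Rightarrow> real) set" where
  "c0_space = {x. x \<longlonglongrightarrow> 0}"

definition c_space :: "(nat \<Rightarrow> real) set" where
  "c_space = {x. convergent x}"

definition linf_space :: "(nat \<Rightarrow> real) set" where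
  "linf_space = {x. bounded (range x)}"

definition l1_space :: "(nat \<Rightarrow> real) set" where
  "l1_space = {x. summable (\<lambda>k. \<bar>x k\<bar>)}"

definition c0_F_hat :: "(nat \<Rightarrow> real) set" where
  "c0_F_hat = {x. F_hat x \<in> c0_space}"

definition bs_space :: "(nat \<Rightarrow> real) set" where
  "bs_space = {x. (\<lambda>n. \<Sum>k\<le>n. x k) \<in> linf_space}"

definition cs_space :: "(nat \<Rightarrow> real) set" where
  "cs_space = {x. (\<lambda>n. \<Sum>k\<le>n. x k) \<in> c_space}"

definition cs0_space :: "(nat \<Rightarrow> real) set" where
  "cs0_space = {x. (\<lambda>n. \<Sum>k\<le>n. x k) \<in> c0_space}"

definition bv1_space :: "(nat \<Rightarrow> real) set" where
  "bv1_space = {x. summable (\<lambda>k. \<bar>x k - (if k = 0 then 0 else x (k - 1))\<bar>)}"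

definition matrix_class ::
    "(nat \<Rightarrow> real) set \<Rightarrow> (nat \<Rightarrow> real) set \<Rightarrow> (nat \<Rightarrow> nat \<Rightarrow> real) set" where
  "matrix_class X Y =
     {A. \<forall>x\<in>X. (\<forall>n. summable (\<lambda>k. A n k * x k)) \<and> (\<lambda>n. \<Sum>k. A n k * x k) \<in> Y}"

definition d_trunc :: "(nat \<Rightarrow> nat \<Rightarrow> real) \<Rightarrow> nat \<Rightarrow> nat \<Rightarrow> nat \<Rightarrow> real" where
  "d_trunc A n m k = (if k \<le> m then \<Sum>j=k..m. (fibo (j + 1))\<^sup>2 / (fibo k * fibo (k + 1)) * A n j else 0)"

(* d_lim and alpha are meaningful only when C2, respectively C4, holds. *)
definition d_lim :: "(nat \<Rightarrow> nat \<Rightarrow> real) \<Rightarrow> nat \<Rightarrow> nat \<Rightarrow> real" where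
  "d_lim A n k = lim (\<lambda>m. d_trunc A n m k)"

definition alpha :: "(nat \<Rightarrow> nat \<Rightarrow> real) \<Rightarrow> nat \<Rightarrow> real" where
  "alpha A k = lim (\<lambda>n. d_lim A n k)"

definition C1 :: "(nat \<Rightarrow> nat \<Rightarrow> real) \<Rightarrow> bool" where
  "C1 A \<longleftrightarrow> (\<forall>n. bdd_above (range (\<lambda>m. \<Sum>k\<le>m. \<bar>d_trunc A n m k\<bar>)))"

definition C2 :: "(nat \<Rightarrow> nat \<Rightarrow> real) \<Rightarrow> bool" where
  "C2 A \<longleftrightarrow> (\<forall>n k. convergent (\<lambda>m. d_trunc A n m k))"

(* Finiteness of the supremum includes finiteness of each series; suminf alone would not say so. *)
definition C3 :: "(nat \<Rightarrow> nat \<Rightarrow> real) \<Rightarrow> bool" where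
  "C3 A \<longleftrightarrow> (\<forall>n. summable (\<lambda>k. \<bar>d_lim A n k\<bar>)) \<and>
            bdd_above (range (\<lambda>n. \<Sum>k. \<bar>d_lim A n k\<bar>))"

definition C4 :: "(nat \<Rightarrow> nat \<Rightarrow> real) \<Rightarrow> bool" where
  "C4 A \<longleftrightarrow> (\<forall>k. convergent (\<lambda>n. d_lim A n k))"

definition C5 :: "(nat \<Rightarrow> nat \<Rightarrow> real) \<Rightarrow> bool" where
  "C5 A \<longleftrightarrow> bdd_above ((\<lambda>(N, K). \<bar>\<Sum>n\<in>N. \<Sum>k\<in>K. d_lim A n k\<bar>) `
              ({N. finite N} \<times> {K. finite K}))"

definition A_Sigma :: "(nat \<Rightarrow> nat \<Rightarrow> real) \<Rightarrow> nat \<Rightarrow> nat \<Rightarrow> real" where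
  "A_Sigma A n k = (\<Sum>j\<le>n. A j k)"

definition A_Delta :: "(nat \<Rightarrow> nat \<Rightarrow> real) \<Rightarrow> nat \<Rightarrow> nat \<Rightarrow> real" where
  "A_Delta A n k = A n k - (if n = 0 then 0 else A (n - 1) k)"

end

theory Submission
  imports Defs
begin

text \<open>
  The difference operator \<open>F_hat\<close> is a bijection of the space of all sequences, with a lower
  triangular inverse \<open>F_hat_inv\<close>. Writing \<open>x = F_hat_inv y\<close> identifies \<open>c0_F_hat\<close> with
  \<open>c0_space\<close>, and interchanging two finite sums shows that the \<open>m\<close>-th partial sum of the series
  \<open>A n k * x k\<close> is the value at \<open>y\<close> of the \<open>m\<close>-th row of the matrix \<open>d_trunc A n\<close>. Hence row \<open>n\<close>
  of \<open>A\<close> can be applied to all of \<open>c0_F_hat\<close> exactly if \<open>d_trunc A n\<close> maps null sequences to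
  convergent ones, which is what \<open>C1\<close> and \<open>C2\<close> say about it, and the value of the series is then
  that of row \<open>n\<close> of \<open>d_lim A\<close> at \<open>y\<close>. So every class of matrices on \<open>c0_F_hat\<close> reduces to
  one on the space of null sequences (\<open>matrix_class_c0_F_hat_iff\<close>).

  What remains is to describe the matrices that map null sequences into bounded, convergent, null and
  absolutely summable sequences. That the conditions are necessary rests on the principle of uniform
  boundedness for functionals on null sequences (\<open>uniform_boundedness_c0\<close>), applied to the
  rows of the matrix, to the truncations of one row, or to finite sums of rows, together with
  evaluation at the unit sequences. That they are sufficient is immediate for bounded
  sequences; for convergent and null sequences it rests on the interchange of limit and summation for
  matrices with uniformly bounded absolute row sums (\<open>bounded_rows_limit\<close>), and for absolutely
  summable sequences on splitting finite sums by sign (\<open>sum_abs_le_twice\<close>).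

  The spaces defined by partial sums or by differences are reduced to the others by passing to
  \<open>A_Sigma A\<close> and \<open>A_Delta A\<close>, since the triangular changes of rows involved are invertible and
  therefore do not affect the convergence of the series.
\<close>

section \<open>Functionals on null sequences\<close>

lemma summable_mult_null:
  fixes b y :: "nat \<Rightarrow> real"
  assumes b: "summable (\<lambda>k. \<bar>b k\<bar>)" and y: "y \<longlonglongrightarrow> 0"
  shows "summable (\<lambda>k. \<bar>b k * y k\<bar>)"
proof -
  have "Bseq y" using y convergentI convergent_imp_Bseq by blast
  then obtain B where B: "\<And>k. \<bar>y k\<bar> \<le> B"
    by (auto simp: Bseq_def)
  have "summable (\<lambda>k. \<bar>b k\<bar> * B)" using b by (rule summable_mult2)
  then show ?thesis
    by (rule summable_comparison_test'[where N = 0])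
       (auto simp: abs_mult intro!: mult_left_mono B)
qed

text \<open>
  For \<open>K = 0\<close> this bounds the functional given by \<open>b\<close> in terms of its norm. For large \<open>K\<close> either
  factor on the right can be the small one: the bound \<open>e\<close> on the far terms of \<open>y\<close>, or the remainder
  of the series of \<open>\<bar>b k\<bar>\<close>.
\<close>

lemma abs_suminf_tail_le:
  fixes b y :: "nat \<Rightarrow> real"
  assumes b: "summable (\<lambda>k. \<bar>b k\<bar>)" and y: "y \<longlonglongrightarrow> 0" and e: "\<And>k. k \<ge> K \<Longrightarrow> \<bar>y k\<bar> \<le> e"
  shows "\<bar>(\<Sum>k. b k * y k) - (\<Sum>k<K. b k * y k)\<bar> \<le> e * (\<Sum>k. \<bar>b (k + K)\<bar>)"
proof -
  have s: "summable (\<lambda>k. \<bar>b k * y k\<bar>)" by (rule summable_mult_null[OF b y])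
  have s': "summable (\<lambda>k. \<bar>b (k + K) * y (k + K)\<bar>)"
    using summable_ignore_initial_segment[OF s] .
  have b': "summable (\<lambda>k. \<bar>b (k + K)\<bar>)"
    using summable_ignore_initial_segment[OF b] .
  have "(\<Sum>k. b k * y k) - (\<Sum>k<K. b k * y k) = (\<Sum>k. b (k + K) * y (k + K))"
    using suminf_split_initial_segment[OF summable_rabs_cancel[OF s], of K] by simp
  also have "\<bar>\<dots>\<bar> \<le> (\<Sum>k. \<bar>b (k + K) * y (k + K)\<bar>)"
    by (rule summable_rabs[OF s'])
  also have "\<dots> \<le> (\<Sum>k. e * \<bar>b (k + K)\<bar>)"
  proof (rule suminf_le[OF _ s' summable_mult[OF b']])
    show "\<bar>b (k + K) * y (k + K)\<bar> \<le> e * \<bar>b (k + K)\<bar>" for k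
      using mult_right_mono[OF e[of "k + K"] abs_ge_zero[of "b (k + K)"]]
      by (simp add: abs_mult mult.commute)
  qed
  also have "\<dots> = e * (\<Sum>k. \<bar>b (k + K)\<bar>)" by (rule suminf_mult[OF b'])
  finally show ?thesis .
qed

lemma sum_mult_unit:
  fixes b :: "nat \<Rightarrow> real"
  shows "(\<lambda>k. b k * (if k = j then 1 else 0)) sums b j"
  using sums_single[of j b] by (simp add: if_distrib cong: if_cong)

lemma unit_null: "(\<lambda>k. if k = j then 1 else 0 :: real) \<longlonglongrightarrow> 0"
  by (rule tendsto_eventually) (auto simp: eventually_sequentially intro!: exI[of _ "Suc j"])

text \<open>
  The principle of uniform boundedness, proved by a gliding hump. Evaluation at unit sequences
  bounds each coordinate of the family, so if the norms were unbounded, then members of the family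
  with arbitrarily large mass beyond any given index would exist. Choosing such members one after
  another gives consecutive blocks of indices, the \<open>j\<close>-th of which carries nearly all of the mass that
  the \<open>j\<close>-th member has beyond the start of this block. The sequence that on the
  \<open>j\<close>-th block is \<open>1 / (j + 1)\<close> times the sign of the \<open>j\<close>-th member tends to zero, but the chosen
  members take arbitrarily large values at it.
\<close>

lemma uniform_boundedness_c0:
  fixes b :: "'i \<Rightarrow> nat \<Rightarrow> real"
  assumes b: "\<And>i. i \<in> I \<Longrightarrow> summable (\<lambda>k. \<bar>b i k\<bar>)"
    and ptw: "\<And>y. y \<longlonglongrightarrow> 0 \<Longrightarrow> \<exists>C. \<forall>i\<in>I. \<bar>\<Sum>k. b i k * y k\<bar> \<le> C"
  shows "\<exists>M. \<forall>i\<in>I. (\<Sum>k. \<bar>b i k\<bar>) \<le> M"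
proof (rule ccontr)
  assume unbdd: "\<not> ?thesis"
  have "\<exists>C. \<forall>i\<in>I. \<bar>b i k\<bar> \<le> C" for k
    using ptw[OF unit_null[of k]] by (simp add: sums_unique[OF sum_mult_unit, symmetric])
  then obtain C where C: "\<And>i k. i \<in> I \<Longrightarrow> \<bar>b i k\<bar> \<le> C k" by metis
  \<comment> \<open>On block \<open>j\<close> the test sequence is \<open>1 / (j + 1)\<close> times a sign; the contribution of the
    block has to be at least \<open>j\<close> even after the earlier terms, at most the sum of \<open>C k\<close> for \<open>k < N\<close>, and
    the later terms, at most \<open>1\<close>, have been taken off.\<close>
  define R where "R N j = real (Suc j) * (real j + 1 + (\<Sum>k<N. C k))" for N j
  \<comment> \<open>The pair \<open>p\<close> consists of the member chosen for a block and the end of that block.\<close>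
  have "\<exists>p. fst p \<in> I \<and> snd p > N \<and> (\<Sum>k=N..<snd p. \<bar>b (fst p) k\<bar>) \<ge> R N j
           \<and> (\<Sum>k. \<bar>b (fst p) (k + snd p)\<bar>) \<le> 1" for N j
  proof -
    obtain i where i: "i \<in> I" and big: "(\<Sum>k. \<bar>b i k\<bar>) > (\<Sum>k<N. C k) + R N j + 1"
      using unbdd by (meson not_le)
    let ?s = "\<Sum>k. \<bar>b i k\<bar>"
    have "(\<lambda>n. \<Sum>k<n. \<bar>b i k\<bar>) \<longlonglongrightarrow> ?s"
      using b[OF i] by (rule summable_LIMSEQ)
    from LIMSEQ_D[OF this, of 1] obtain n0
      where n0: "\<And>n. n \<ge> n0 \<Longrightarrow> \<bar>(\<Sum>k<n. \<bar>b i k\<bar>) - ?s\<bar> < 1" by auto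
    define N' where "N' = max n0 (Suc N)"
    have N': "N' > N" and near: "\<bar>(\<Sum>k<N'. \<bar>b i k\<bar>) - ?s\<bar> < 1"
      using n0[of N'] by (auto simp: N'_def)
    have split: "(\<Sum>k<N'. \<bar>b i k\<bar>) = (\<Sum>k<N. \<bar>b i k\<bar>) + (\<Sum>k=N..<N'. \<bar>b i k\<bar>)"
      using N' by (simp add: lessThan_atLeast0 sum.atLeastLessThan_concat)
    have "(\<Sum>k<N. \<bar>b i k\<bar>) \<le> (\<Sum>k<N. C k)" by (intro sum_mono C i)
    then have "(\<Sum>k=N..<N'. \<bar>b i k\<bar>) \<ge> R N j" using big near split by linarith
    moreover have "(\<Sum>k. \<bar>b i (k + N')\<bar>) \<le> 1"
      using suminf_split_initial_segment[OF b[OF i], of N'] near by linarith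
    ultimately show ?thesis using i N' by (intro exI[of _ "(i, N')"]) auto
  qed
  then obtain p where p: "\<And>N j. fst (p N j) \<in> I" "\<And>N j. snd (p N j) > N"
      "\<And>N j. (\<Sum>k=N..<snd (p N j). \<bar>b (fst (p N j)) k\<bar>) \<ge> R N j"
      "\<And>N j. (\<Sum>k. \<bar>b (fst (p N j)) (k + snd (p N j))\<bar>) \<le> 1"
    by metis
  define N where "N = rec_nat 0 (\<lambda>j n. snd (p n j))"
  have N_Suc: "N (Suc j) = snd (p (N j) j)" for j by (simp add: N_def)
  have N0: "N 0 = 0" by (simp add: N_def)
  define i where "i j = fst (p (N j) j)" for j
  have iI: "i j \<in> I" for j by (simp add: i_def p)
  have hump: "(\<Sum>k=N j..<N (Suc j). \<bar>b (i j) k\<bar>) \<ge> R (N j) j" for j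
    by (simp add: i_def N_Suc p)
  have tail: "(\<Sum>k. \<bar>b (i j) (k + N (Suc j))\<bar>) \<le> 1" for j
    by (simp add: i_def N_Suc p)
  have smN: "strict_mono N" by (simp add: strict_mono_Suc_iff N_Suc p)
  define blk where "blk k = (LEAST j. k < N (Suc j))" for k
  have blk_eq: "blk k = j" if "N j \<le> k" "k < N (Suc j)" for j k
    unfolding blk_def
  proof (rule Least_equality)
    show "j \<le> j'" if "k < N (Suc j')" for j'
    proof (rule ccontr)
      assume "\<not> j \<le> j'"
      then have "N (Suc j') \<le> N j" by (simp add: strict_mono_less_eq[OF smN])
      with that \<open>N j \<le> k\<close> show False by simp
    qed
  qed fact
  have blk_ge: "blk k \<ge> j" if "N j \<le> k" for j k
  proof (rule ccontr)
    assume "\<not> blk k \<ge> j"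
    then have "N (Suc (blk k)) \<le> N j" by (simp add: strict_mono_less_eq[OF smN])
    moreover have "k < N (Suc (blk k))" unfolding blk_def
      by (rule LeastI[of _ k]) (meson Suc_le_eq smN strict_mono_imp_increasing)
    ultimately show False using that by simp
  qed
  define y where "y k = sgn (b (i (blk k)) k) / real (Suc (blk k))" for k
  have y_le: "\<bar>y k\<bar> \<le> 1 / real (Suc (blk k))" for k
    by (auto simp: y_def sgn_real_def)
  have y1: "\<bar>y k\<bar> \<le> 1" for k
    by (rule order_trans[OF y_le]) simp
  have y0: "y \<longlonglongrightarrow> 0"
  proof (rule LIMSEQ_I)
    fix r :: real assume "r > 0"
    then obtain j where j: "1 / real (Suc j) < r" using nat_approx_posE by blast
    have "norm (y k - 0) < r" if "k \<ge> N j" for k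
    proof -
      have "1 / real (Suc (blk k)) \<le> 1 / real (Suc j)"
        using blk_ge[OF that] by (intro divide_left_mono) auto
      then show ?thesis using y_le[of k] j by simp
    qed
    then show "\<exists>no. \<forall>k\<ge>no. norm (y k - 0) < r" by blast
  qed
  obtain B where B: "\<And>i. i \<in> I \<Longrightarrow> \<bar>\<Sum>k. b i k * y k\<bar> \<le> B" using ptw[OF y0] by blast
  have "real j \<le> B" for j
  proof -
    let ?b = "b (i j)" and ?N = "N j" and ?N' = "N (Suc j)"
    have "\<bar>(\<Sum>k. ?b k * y k) - (\<Sum>k<?N'. ?b k * y k)\<bar> \<le> 1 * (\<Sum>k. \<bar>?b (k + ?N')\<bar>)"
      by (rule abs_suminf_tail_le[OF b[OF iI] y0 y1])
    then have 1: "\<bar>(\<Sum>k. ?b k * y k) - (\<Sum>k<?N'. ?b k * y k)\<bar> \<le> 1"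
      using tail[of j] by simp
    have 2: "(\<Sum>k<?N'. ?b k * y k) = (\<Sum>k<?N. ?b k * y k) + (\<Sum>k=?N..<?N'. ?b k * y k)"
      by (simp add: lessThan_atLeast0 sum.atLeastLessThan_concat strict_mono_less_eq[OF smN])
    have "\<bar>\<Sum>k<?N. ?b k * y k\<bar> \<le> (\<Sum>k<?N. \<bar>?b k * y k\<bar>)" by (rule sum_abs)
    also have "\<dots> \<le> (\<Sum>k<?N. C k)"
    proof (rule sum_mono)
      show "\<bar>?b k * y k\<bar> \<le> C k" for k
        using mult_mono[OF C[OF iI, of j k] y1[of k]] C[OF iI, of j k] by (simp add: abs_mult)
    qed
    finally have 3: "\<bar>\<Sum>k<?N. ?b k * y k\<bar> \<le> (\<Sum>k<?N. C k)" .
    have "(\<Sum>k=?N..<?N'. ?b k * y k) = (\<Sum>k=?N..<?N'. \<bar>?b k\<bar> / real (Suc j))"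
      by (intro sum.cong) (auto simp: y_def blk_eq abs_sgn)
    also have "\<dots> = (\<Sum>k=?N..<?N'. \<bar>?b k\<bar>) / real (Suc j)"
      by (simp add: sum_divide_distrib)
    also have "\<dots> \<ge> R ?N j / real (Suc j)" by (intro divide_right_mono hump) simp
    finally have 4: "(\<Sum>k=?N..<?N'. ?b k * y k) \<ge> real j + 1 + (\<Sum>k<?N. C k)"
      by (simp add: R_def del: of_nat_Suc)
    show ?thesis using 1 2 3 4 B[OF iI, of j] by linarith
  qed
  then show False using reals_Archimedean2[of B] by (meson not_le)
qed

text \<open>
  The truncations of \<open>b\<close> are bounded pointwise on null sequences, because partial sums of convergent
  series are bounded; their norms are the partial sums of \<open>\<bar>b k\<bar>\<close>.
\<close>

lemma beta_dual_c0:
  fixes b :: "nat \<Rightarrow> real"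
  assumes "\<And>y. y \<longlonglongrightarrow> 0 \<Longrightarrow> summable (\<lambda>k. b k * y k)"
  shows "summable (\<lambda>k. \<bar>b k\<bar>)"
proof -
  define t where "t m k = (if k < m then b k else 0)" for m k
  have t: "(\<Sum>k. t m k * y k) = (\<Sum>k<m. b k * y k)" "summable (\<lambda>k. \<bar>t m k\<bar>)"
    "(\<Sum>k. \<bar>t m k\<bar>) = (\<Sum>k<m. \<bar>b k\<bar>)" for m y
  proof -
    show "(\<Sum>k. t m k * y k) = (\<Sum>k<m. b k * y k)"
      by (subst suminf_finite[of "{..<m}"]) (auto simp: t_def)
    show "summable (\<lambda>k. \<bar>t m k\<bar>)"
      by (rule summable_finite[of "{..<m}"]) (auto simp: t_def)
    show "(\<Sum>k. \<bar>t m k\<bar>) = (\<Sum>k<m. \<bar>b k\<bar>)"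
      by (subst suminf_finite[of "{..<m}"]) (auto simp: t_def)
  qed
  have "\<exists>M. \<forall>m\<in>UNIV. (\<Sum>k. \<bar>t m k\<bar>) \<le> M"
  proof (rule uniform_boundedness_c0)
    fix y :: "nat \<Rightarrow> real" assume "y \<longlonglongrightarrow> 0"
    then have "Bseq (\<lambda>m. \<Sum>k<m. b k * y k)"
      using assms summable_LIMSEQ convergentI convergent_imp_Bseq by blast
    then show "\<exists>C. \<forall>m\<in>UNIV. \<bar>\<Sum>k. t m k * y k\<bar> \<le> C"
      by (auto simp: Bseq_def t)
  qed (rule t)
  then obtain M where "\<And>m. (\<Sum>k<m. \<bar>b k\<bar>) \<le> M" by (auto simp: t)
  then show ?thesis by (intro summableI_nonneg_bounded) auto
qed

section \<open>Matrix transformations of null sequences\<close>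

lemma matrix_class_c0_rows:
  assumes "D \<in> matrix_class c0_space Y"
  shows "summable (\<lambda>k. \<bar>D n k\<bar>)"
  using assms by (intro beta_dual_c0) (auto simp: matrix_class_def c0_space_def)

lemma matrix_class_c0_iff:
  "D \<in> matrix_class c0_space Y \<longleftrightarrow>
     (\<forall>n. summable (\<lambda>k. \<bar>D n k\<bar>)) \<and> (\<forall>y. y \<longlonglongrightarrow> 0 \<longrightarrow> (\<lambda>n. \<Sum>k. D n k * y k) \<in> Y)"
  (is "?L \<longleftrightarrow> ?R")
proof
  assume ?L
  then show ?R using matrix_class_c0_rows[of D Y] by (auto simp: matrix_class_def c0_space_def)
next
  assume ?R
  then show ?L
    by (auto simp: matrix_class_def c0_space_def intro: summable_rabs_cancel summable_mult_null)
qed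

definition bounded_rows :: "(nat \<Rightarrow> nat \<Rightarrow> real) \<Rightarrow> bool" where
  "bounded_rows D \<longleftrightarrow> (\<forall>n. summable (\<lambda>k. \<bar>D n k\<bar>)) \<and> bdd_above (range (\<lambda>n. \<Sum>k. \<bar>D n k\<bar>))"

lemma bounded_range_iff: "bounded (range (x :: nat \<Rightarrow> real)) \<longleftrightarrow> (\<exists>C. \<forall>n. \<bar>x n\<bar> \<le> C)"
  by (auto simp: bounded_iff)

lemma matrix_class_c0_linf: "D \<in> matrix_class c0_space linf_space \<longleftrightarrow> bounded_rows D"
proof
  assume L: "D \<in> matrix_class c0_space linf_space"
  have "\<exists>M. \<forall>n\<in>UNIV. (\<Sum>k. \<bar>D n k\<bar>) \<le> M"
    by (rule uniform_boundedness_c0)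
       (use L in \<open>auto simp: matrix_class_c0_iff linf_space_def bounded_range_iff\<close>)
  then show "bounded_rows D"
    using matrix_class_c0_rows[OF L] by (auto simp: bounded_rows_def bdd_above_def)
next
  assume D: "bounded_rows D"
  then obtain M where M: "\<And>n. (\<Sum>k. \<bar>D n k\<bar>) \<le> M" and s: "\<And>n. summable (\<lambda>k. \<bar>D n k\<bar>)"
    by (auto simp: bounded_rows_def bdd_above_def)
  have "\<exists>C. \<forall>n. \<bar>\<Sum>k. D n k * y k\<bar> \<le> C" if y: "y \<longlonglongrightarrow> 0" for y
  proof -
    have "Bseq y" using y convergentI convergent_imp_Bseq by blast
    then obtain B where B: "B > 0" "\<And>k. \<bar>y k\<bar> \<le> B" by (auto simp: Bseq_def)
    have "\<bar>\<Sum>k. D n k * y k\<bar> \<le> B * (\<Sum>k. \<bar>D n k\<bar>)" for n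
      using abs_suminf_tail_le[OF s[of n] y B(2), of 0] by simp
    also have "B * (\<Sum>k. \<bar>D n k\<bar>) \<le> B * M" for n
      using B(1) by (intro mult_left_mono M) simp
    finally have "\<bar>\<Sum>k. D n k * y k\<bar> \<le> B * M" for n .
    then show ?thesis by blast
  qed
  then show "D \<in> matrix_class c0_space linf_space"
    using s by (simp add: matrix_class_c0_iff linf_space_def bounded_range_iff)
qed

text \<open>
  A uniform bound on the absolute row sums makes the tails of the series \<open>D n k * y k\<close> uniformly
  small in \<open>n\<close> for each null sequence \<open>y\<close>, so that the limit in \<open>n\<close> may be taken term by term. It is
  used both for passing from \<open>d_trunc\<close> to \<open>d_lim\<close> and for the images of null sequences under \<open>d_lim\<close>.
\<close>

lemma bounded_rows_limit:
  assumes D: "bounded_rows D" and lim: "\<And>k. (\<lambda>n. D n k) \<longlonglongrightarrow> a k"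
  shows "summable (\<lambda>k. \<bar>a k\<bar>)"
    and "y \<longlonglongrightarrow> 0 \<Longrightarrow> (\<lambda>n. \<Sum>k. D n k * y k) \<longlonglongrightarrow> (\<Sum>k. a k * y k)"
proof -
  obtain M where M: "\<And>n. (\<Sum>k. \<bar>D n k\<bar>) \<le> M" and s: "\<And>n. summable (\<lambda>k. \<bar>D n k\<bar>)"
    using D by (auto simp: bounded_rows_def bdd_above_def)
  have part: "(\<Sum>k<K. \<bar>a k\<bar>) \<le> M" for K
  proof (rule LIMSEQ_le_const2)
    show "(\<lambda>n. \<Sum>k<K. \<bar>D n k\<bar>) \<longlonglongrightarrow> (\<Sum>k<K. \<bar>a k\<bar>)" by (intro tendsto_intros lim)
    have "(\<Sum>k<K. \<bar>D n k\<bar>) \<le> M" for n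
      using sum_le_suminf[OF s[of n], of "{..<K}"] M[of n] by simp
    then show "\<exists>N. \<forall>n\<ge>N. (\<Sum>k<K. \<bar>D n k\<bar>) \<le> M" by blast
  qed
  show sa: "summable (\<lambda>k. \<bar>a k\<bar>)"
    by (rule summableI_nonneg_bounded[OF _ part]) simp
  have M0: "M \<ge> 0" using part[of 0] by simp
  assume y: "y \<longlonglongrightarrow> 0"
  show "(\<lambda>n. \<Sum>k. D n k * y k) \<longlonglongrightarrow> (\<Sum>k. a k * y k)"
  proof (rule LIMSEQ_I)
    fix r :: real assume r: "r > 0"
    define e where "e = r / (3 * (M + 1))"
    have e: "e > 0" and eM: "e * M \<le> r / 3" using r M0 by (auto simp: e_def field_simps)
    obtain K where K: "\<And>k. k \<ge> K \<Longrightarrow> \<bar>y k\<bar> \<le> e"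
      using LIMSEQ_D[OF y e] by (auto intro: less_imp_le)
    have tail: "\<bar>(\<Sum>k. b k * y k) - (\<Sum>k<K. b k * y k)\<bar> \<le> r / 3"
      if b: "summable (\<lambda>k. \<bar>b k\<bar>)" and bM: "(\<Sum>k. \<bar>b k\<bar>) \<le> M" for b
    proof -
      have "(\<Sum>k. \<bar>b (k + K)\<bar>) \<le> M"
        using suminf_split_initial_segment[OF b, of K] bM
          sum_nonneg[of "{..<K}" "\<lambda>k. \<bar>b k\<bar>", OF abs_ge_zero] by linarith
      then have "e * (\<Sum>k. \<bar>b (k + K)\<bar>) \<le> r / 3"
        using mult_left_mono[of "\<Sum>k. \<bar>b (k + K)\<bar>" M e] e eM by linarith
      moreover have "\<bar>(\<Sum>k. b k * y k) - (\<Sum>k<K. b k * y k)\<bar> \<le> e * (\<Sum>k. \<bar>b (k + K)\<bar>)"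
        by (rule abs_suminf_tail_le[OF b y]) (rule K)
      ultimately show ?thesis by linarith
    qed
    have "(\<lambda>n. \<Sum>k<K. D n k * y k) \<longlonglongrightarrow> (\<Sum>k<K. a k * y k)"
      by (intro tendsto_intros lim)
    from LIMSEQ_D[OF this, of "r / 3"] r obtain n0
      where n0: "\<And>n. n \<ge> n0 \<Longrightarrow> \<bar>(\<Sum>k<K. D n k * y k) - (\<Sum>k<K. a k * y k)\<bar> < r / 3" by auto
    have "norm ((\<Sum>k. D n k * y k) - (\<Sum>k. a k * y k)) < r" if "n \<ge> n0" for n
      using n0[OF that] tail[OF s[of n] M] tail[OF sa suminf_le_const[OF sa part]]
      unfolding real_norm_def by linarith
    then show "\<exists>no. \<forall>n\<ge>no. norm ((\<Sum>k. D n k * y k) - (\<Sum>k. a k * y k)) < r" by blast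
  qed
qed

lemma matrix_class_c0_column:
  assumes "D \<in> matrix_class c0_space Y"
  shows "(\<lambda>n. D n k) \<in> Y"
proof -
  have "(\<lambda>n. \<Sum>j. D n j * (if j = k then 1 else 0)) \<in> Y"
    using assms unit_null[of k] unfolding matrix_class_c0_iff by blast
  then show ?thesis by (simp add: sums_unique[OF sum_mult_unit, symmetric])
qed

lemma matrix_class_mono: "Y \<subseteq> Z \<Longrightarrow> matrix_class X Y \<subseteq> matrix_class X Z"
  by (auto simp: matrix_class_def)

lemma c_subset_linf: "c_space \<subseteq> linf_space"
  by (auto simp: c_space_def linf_space_def convergent_imp_bounded convergent_def)

lemma c0_subset_c: "c0_space \<subseteq> c_space"
  by (auto simp: c0_space_def c_space_def convergent_def)

lemma matrix_class_c0_c: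
  "D \<in> matrix_class c0_space c_space \<longleftrightarrow> bounded_rows D \<and> (\<forall>k. convergent (\<lambda>n. D n k))"
proof safe
  assume L: "D \<in> matrix_class c0_space c_space"
  show "bounded_rows D"
    using L matrix_class_mono[OF c_subset_linf] matrix_class_c0_linf by blast
  show "convergent (\<lambda>n. D n k)" for k
    using matrix_class_c0_column[OF L] by (simp add: c_space_def)
next
  assume D: "bounded_rows D" and "\<forall>k. convergent (\<lambda>n. D n k)"
  then have "\<And>k. (\<lambda>n. D n k) \<longlonglongrightarrow> lim (\<lambda>n. D n k)" by (simp add: convergent_LIMSEQ_iff)
  from bounded_rows_limit(2)[OF D this] show "D \<in> matrix_class c0_space c_space"
    using D unfolding matrix_class_c0_iff c_space_def bounded_rows_def convergent_def by blast
qed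

lemma matrix_class_c0_c0:
  "D \<in> matrix_class c0_space c0_space \<longleftrightarrow> bounded_rows D \<and> (\<forall>k. (\<lambda>n. D n k) \<longlonglongrightarrow> 0)"
proof safe
  assume L: "D \<in> matrix_class c0_space c0_space"
  show "bounded_rows D"
    using L matrix_class_mono[OF c0_subset_c] matrix_class_c0_c by blast
  show "(\<lambda>n. D n k) \<longlonglongrightarrow> 0" for k
    using matrix_class_c0_column[OF L] by (simp add: c0_space_def)
next
  assume D: "bounded_rows D" and "\<forall>k. (\<lambda>n. D n k) \<longlonglongrightarrow> 0"
  then have "y \<longlonglongrightarrow> 0 \<Longrightarrow> (\<lambda>n. \<Sum>k. D n k * y k) \<longlonglongrightarrow> 0" for y
    using bounded_rows_limit(2)[OF D, of "\<lambda>_. 0" y] by simp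
  then show "D \<in> matrix_class c0_space c0_space"
    using D unfolding matrix_class_c0_iff by (simp add: c0_space_def bounded_rows_def)
qed

text \<open>
  Summing separately over the nonnegative and over the negative terms loses at most a factor of two.
\<close>

lemma sum_abs_le_twice:
  fixes f :: "'a \<Rightarrow> real"
  assumes "finite K" and "\<And>J. J \<subseteq> K \<Longrightarrow> \<bar>sum f J\<bar> \<le> M"
  shows "(\<Sum>k\<in>K. \<bar>f k\<bar>) \<le> 2 * M"
proof -
  let ?P = "{k\<in>K. f k \<ge> 0}" and ?Q = "{k\<in>K. f k < 0}"
  have "(\<Sum>k\<in>K. \<bar>f k\<bar>) = (\<Sum>k\<in>?P. \<bar>f k\<bar>) + (\<Sum>k\<in>?Q. \<bar>f k\<bar>)"
    using assms(1) by (subst sum.union_disjoint[symmetric]) (auto intro!: sum.cong)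
  also have "\<dots> = sum f ?P - sum f ?Q"
    by (simp add: sum_negf[symmetric])
  also have "\<dots> \<le> 2 * M" using assms(2)[of ?P] assms(2)[of ?Q] by fastforce
  finally show ?thesis .
qed

lemma summable_if_bounded_finite_sums:
  fixes f :: "nat \<Rightarrow> real"
  assumes "\<And>K. finite K \<Longrightarrow> \<bar>sum f K\<bar> \<le> M"
  shows "summable (\<lambda>k. \<bar>f k\<bar>)"
  using assms by (intro summableI_nonneg_bounded[where x = "2 * M"] sum_abs_le_twice)
    (auto intro: finite_subset)

lemma suminf_mult_sum:
  fixes D :: "'i \<Rightarrow> nat \<Rightarrow> real"
  assumes "\<And>n. summable (\<lambda>k. \<bar>D n k\<bar>)" and "y \<longlonglongrightarrow> 0"
  shows "(\<Sum>k. (\<Sum>n\<in>N. D n k) * y k) = (\<Sum>n\<in>N. \<Sum>k. D n k * y k)"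
  using assms by (simp add: sum_distrib_right suminf_sum summable_rabs_cancel[OF summable_mult_null])

text \<open>
  If \<open>D\<close> maps null sequences to absolutely summable ones, then the finite sums of its rows form a
  pointwise bounded family of functionals, to which uniform boundedness applies. Conversely, the
  bound on finite double sums gives, by splitting the columns by sign, a bound on the norms of these
  finite sums of rows, hence on all finite sums of terms of \<open>D y\<close>, and splitting once more by sign
  bounds the finite sums of their absolute values.
\<close>

lemma matrix_class_c0_l1:
  "D \<in> matrix_class c0_space l1_space \<longleftrightarrow>
     (\<exists>M. \<forall>N K. finite N \<longrightarrow> finite K \<longrightarrow> \<bar>\<Sum>n\<in>N. \<Sum>k\<in>K. D n k\<bar> \<le> M)"
proof
  assume L: "D \<in> matrix_class c0_space l1_space"
  note s = matrix_class_c0_rows[OF L]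
  have sN: "summable (\<lambda>k. \<bar>\<Sum>n\<in>N. D n k\<bar>)" for N
    by (rule summable_comparison_test'[OF summable_sum[of N "\<lambda>n k. \<bar>D n k\<bar>"], where N = 0])
       (auto intro: s)
  have "\<exists>M. \<forall>N\<in>{N. finite N}. (\<Sum>k. \<bar>\<Sum>n\<in>N. D n k\<bar>) \<le> M"
  proof (rule uniform_boundedness_c0[OF sN])
    fix y :: "nat \<Rightarrow> real" assume y: "y \<longlonglongrightarrow> 0"
    let ?x = "\<lambda>n. \<Sum>k. D n k * y k"
    have x: "summable (\<lambda>n. \<bar>?x n\<bar>)"
      using L y by (auto simp: matrix_class_c0_iff l1_space_def)
    have "\<bar>sum ?x N\<bar> \<le> (\<Sum>n. \<bar>?x n\<bar>)" if "finite N" for N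
      by (rule order_trans[OF sum_abs sum_le_suminf[OF x that]]) simp
    then show "\<exists>C. \<forall>N\<in>{N. finite N}. \<bar>\<Sum>k. (\<Sum>n\<in>N. D n k) * y k\<bar> \<le> C"
      by (auto simp: suminf_mult_sum[of D, OF s y])
  qed
  then obtain M where M: "\<And>N. finite N \<Longrightarrow> (\<Sum>k. \<bar>\<Sum>n\<in>N. D n k\<bar>) \<le> M" by blast
  have "\<bar>\<Sum>n\<in>N. \<Sum>k\<in>K. D n k\<bar> \<le> M" if "finite N" "finite K" for N K
  proof -
    have "\<bar>\<Sum>n\<in>N. \<Sum>k\<in>K. D n k\<bar> \<le> (\<Sum>k\<in>K. \<bar>\<Sum>n\<in>N. D n k\<bar>)"
      by (subst sum.swap) (rule sum_abs)
    also have "\<dots> \<le> (\<Sum>k. \<bar>\<Sum>n\<in>N. D n k\<bar>)" using sN that by (intro sum_le_suminf) auto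
    finally show ?thesis using M[OF that(1)] by simp
  qed
  then show "\<exists>M. \<forall>N K. finite N \<longrightarrow> finite K \<longrightarrow> \<bar>\<Sum>n\<in>N. \<Sum>k\<in>K. D n k\<bar> \<le> M" by blast
next
  assume "\<exists>M. \<forall>N K. finite N \<longrightarrow> finite K \<longrightarrow> \<bar>\<Sum>n\<in>N. \<Sum>k\<in>K. D n k\<bar> \<le> M"
  then obtain M where M: "\<And>N K. finite N \<Longrightarrow> finite K \<Longrightarrow> \<bar>\<Sum>n\<in>N. \<Sum>k\<in>K. D n k\<bar> \<le> M" by blast
  have s: "summable (\<lambda>k. \<bar>D n k\<bar>)" for n
    using M[of "{n}"] by (intro summable_if_bounded_finite_sums[where M = M]) simp
  have "summable (\<lambda>n. \<bar>\<Sum>k. D n k * y k\<bar>)" if y: "y \<longlonglongrightarrow> 0" for y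
  proof -
    have "Bseq y" using y convergentI convergent_imp_Bseq by blast
    then obtain B where B: "B > 0" "\<And>k. \<bar>y k\<bar> \<le> B" by (auto simp: Bseq_def)
    show ?thesis
    proof (rule summable_if_bounded_finite_sums)
      fix N :: "nat set" assume N: "finite N"
      let ?c = "\<lambda>k. \<Sum>n\<in>N. D n k"
      have c: "\<bar>sum ?c K\<bar> \<le> M" if "finite K" for K
        using M[OF N that] by (subst sum.swap)
      have c': "summable (\<lambda>k. \<bar>?c k\<bar>)" by (rule summable_if_bounded_finite_sums[OF c])
      have "(\<Sum>k. \<bar>?c k\<bar>) \<le> 2 * M"
        by (intro suminf_le_const[OF c'] sum_abs_le_twice c) (auto intro: finite_subset)
      then have "B * (\<Sum>k. \<bar>?c k\<bar>) \<le> B * (2 * M)" using B(1) by simp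
      then show "\<bar>\<Sum>n\<in>N. \<Sum>k. D n k * y k\<bar> \<le> B * (2 * M)"
        using abs_suminf_tail_le[OF c' y B(2), of 0] by (simp add: suminf_mult_sum[of D, OF s y])
    qed
  qed
  with s show "D \<in> matrix_class c0_space l1_space"
    by (simp add: matrix_class_c0_iff l1_space_def)
qed

section \<open>The inverse of the Fibonacci difference operator\<close>

lemma fibo_pos: "fibo n > 0"
  by (simp add: fibo_def fib_neq_0_nat)

definition F_hat_inv :: "(nat \<Rightarrow> real) \<Rightarrow> nat \<Rightarrow> real" where
  "F_hat_inv y k = (\<Sum>j\<le>k. (fibo (k + 1))\<^sup>2 / (fibo j * fibo (j + 1)) * y j)"

lemma F_hat_inv_eq: "F_hat_inv y k = (fibo (k + 1))\<^sup>2 * (\<Sum>j\<le>k. y j / (fibo j * fibo (j + 1)))"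
  by (simp add: F_hat_inv_def sum_distrib_left)

lemma F_hat_F_hat_inv: "F_hat (F_hat_inv y) = y"
proof
  fix n
  show "F_hat (F_hat_inv y) n = y n"
  proof (cases n)
    case 0
    then show ?thesis by (simp add: F_hat_def F_hat_inv_def fibo_0 fibo_1[simplified])
  next
    case (Suc m)
    let ?S = "\<Sum>j\<le>m. y j / (fibo j * fibo (j + 1))"
    have p: "fibo (Suc m) \<noteq> 0" "fibo (Suc (Suc m)) \<noteq> 0"
      using fibo_pos[of "Suc m"] fibo_pos[of "Suc (Suc m)"] by auto
    show ?thesis
      using p unfolding F_hat_def F_hat_inv_eq Suc
      by (simp add: field_simps power2_eq_square)
  qed
qed

text \<open>
  Divided by \<open>fibo j * fibo (j + 1)\<close>, for \<open>j > 0\<close>, the entry \<open>F_hat x j\<close> is the difference of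
  \<open>x j / (fibo (j + 1))\<^sup>2\<close> and the same expression at \<open>j - 1\<close>, so the sum telescopes.
\<close>

lemma F_hat_inv_F_hat: "F_hat_inv (F_hat x) = x"
proof
  fix n
  have "(\<Sum>j\<le>n. F_hat x j / (fibo j * fibo (j + 1))) = x n / (fibo (n + 1))\<^sup>2"
  proof (induction n)
    case 0
    show ?case by (simp add: F_hat_def fibo_0 fibo_1[simplified])
  next
    case (Suc m)
    have p: "fibo (Suc m) \<noteq> 0" "fibo (Suc (Suc m)) \<noteq> 0"
      using fibo_pos[of "Suc m"] fibo_pos[of "Suc (Suc m)"] by auto
    show ?case
      using p Suc by (simp add: F_hat_def field_simps power2_eq_square)
  qed
  then show "F_hat_inv (F_hat x) n = x n"
    using fibo_pos[of "n + 1"] by (simp add: F_hat_inv_eq)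
qed

lemma c0_F_hat_eq: "c0_F_hat = F_hat_inv ` c0_space"
proof
  show "c0_F_hat \<subseteq> F_hat_inv ` c0_space"
    by (metis (mono_tags, lifting) F_hat_inv_F_hat c0_F_hat_def image_eqI mem_Collect_eq subsetI)
  show "F_hat_inv ` c0_space \<subseteq> c0_F_hat"
    by (auto simp: c0_F_hat_def F_hat_F_hat_inv)
qed

text \<open>
  This identity explains the coefficients \<open>d_trunc\<close>: they arise from inserting the inverse
  transform into a partial sum and interchanging the order of summation. The right-hand side is
  written as an infinite series so that it is the image of \<open>y\<close> under the matrix \<open>d_trunc A n\<close>.
\<close>

lemma partial_sum_F_hat_inv:
  "(\<Sum>k\<le>m. A n k * F_hat_inv y k) = (\<Sum>k. d_trunc A n m k * y k)"
proof -
  have "(\<Sum>k. d_trunc A n m k * y k) = (\<Sum>k\<le>m. d_trunc A n m k * y k)"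
    by (rule suminf_finite) (auto simp: d_trunc_def)
  also have "\<dots> = (\<Sum>k\<le>m. A n k * F_hat_inv y k)"
  proof (induction m)
    case 0
    show ?case by (simp add: d_trunc_def F_hat_inv_def)
  next
    case (Suc m)
    let ?w = "\<lambda>k. (fibo (Suc m + 1))\<^sup>2 / (fibo k * fibo (k + 1)) * A n (Suc m)"
    have "(\<Sum>k\<le>Suc m. d_trunc A n (Suc m) k * y k) = (\<Sum>k\<le>Suc m. d_trunc A n m k * y k + ?w k * y k)"
      by (intro sum.cong) (auto simp: d_trunc_def distrib_right atLeastAtMostSuc_conv le_Suc_eq)
    also have "\<dots> = (\<Sum>k\<le>m. d_trunc A n m k * y k) + (\<Sum>k\<le>Suc m. ?w k * y k)"
      by (simp add: sum.distrib d_trunc_def[of A n m "Suc m"])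
    also have "(\<Sum>k\<le>Suc m. ?w k * y k) = A n (Suc m) * F_hat_inv y (Suc m)"
      unfolding F_hat_inv_def sum_distrib_left by (intro sum.cong) auto
    finally show ?case using Suc by simp
  qed
  finally show ?thesis by simp
qed

lemma d_trunc_rows:
  "summable (\<lambda>k. \<bar>d_trunc A n m k\<bar>)"
  "(\<Sum>k. \<bar>d_trunc A n m k\<bar>) = (\<Sum>k\<le>m. \<bar>d_trunc A n m k\<bar>)"
proof -
  show "summable (\<lambda>k. \<bar>d_trunc A n m k\<bar>)"
    by (rule summable_finite[of "{..m}"]) (auto simp: d_trunc_def)
  show "(\<Sum>k. \<bar>d_trunc A n m k\<bar>) = (\<Sum>k\<le>m. \<bar>d_trunc A n m k\<bar>)"
    by (rule suminf_finite) (auto simp: d_trunc_def)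
qed

section \<open>Reduction to null sequences\<close>

lemma C1_C2_iff: "C1 A \<and> C2 A \<longleftrightarrow> (\<forall>n. d_trunc A n \<in> matrix_class c0_space c_space)"
  unfolding matrix_class_c0_c bounded_rows_def C1_def C2_def by (auto simp: d_trunc_rows)

lemma summable_F_hat_inv_iff:
  "(\<forall>y\<in>c0_space. summable (\<lambda>k. A n k * F_hat_inv y k)) \<longleftrightarrow>
     d_trunc A n \<in> matrix_class c0_space c_space"
  unfolding matrix_class_c0_iff
  by (simp add: d_trunc_rows c0_space_def c_space_def)
     (simp add: summable_iff_convergent' partial_sum_F_hat_inv)

lemma suminf_F_hat_inv:
  assumes "d_trunc A n \<in> matrix_class c0_space c_space"
  shows "summable (\<lambda>k. \<bar>d_lim A n k\<bar>)"
    and "y \<in> c0_space \<Longrightarrow> (\<Sum>k. A n k * F_hat_inv y k) = (\<Sum>k. d_lim A n k * y k)"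
proof -
  have D: "bounded_rows (d_trunc A n)" "\<And>k. (\<lambda>m. d_trunc A n m k) \<longlonglongrightarrow> d_lim A n k"
    using assms by (auto simp: matrix_class_c0_c d_lim_def convergent_LIMSEQ_iff)
  show "summable (\<lambda>k. \<bar>d_lim A n k\<bar>)" by (rule bounded_rows_limit(1)[OF D])
  assume "y \<in> c0_space"
  then have "(\<lambda>m. \<Sum>k\<le>m. A n k * F_hat_inv y k) \<longlonglongrightarrow> (\<Sum>k. d_lim A n k * y k)"
    using bounded_rows_limit(2)[OF D] by (simp add: partial_sum_F_hat_inv c0_space_def)
  then show "(\<Sum>k. A n k * F_hat_inv y k) = (\<Sum>k. d_lim A n k * y k)"
    unfolding sums_def_le[symmetric] by (rule sums_unique[symmetric])
qed

text \<open>
  Under \<open>C1\<close> and \<open>C2\<close>, the matrices \<open>A\<close> and \<open>d_lim A\<close> have the same values at \<open>F_hat_inv y\<close> and at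
  \<open>y\<close>, respectively, and these two conditions express that the series of \<open>A\<close> converge.
\<close>

lemma matrix_class_c0_F_hat_iff:
  "A \<in> matrix_class c0_F_hat Y \<longleftrightarrow> C1 A \<and> C2 A \<and> d_lim A \<in> matrix_class c0_space Y"
proof -
  have "A \<in> matrix_class c0_F_hat Y \<longleftrightarrow>
      (\<forall>n. \<forall>y\<in>c0_space. summable (\<lambda>k. A n k * F_hat_inv y k)) \<and>
      (\<forall>y\<in>c0_space. (\<lambda>n. \<Sum>k. A n k * F_hat_inv y k) \<in> Y)"
    by (auto simp: matrix_class_def c0_F_hat_eq)
  also have "\<dots> \<longleftrightarrow> (C1 A \<and> C2 A) \<and> (\<forall>y\<in>c0_space. (\<lambda>n. \<Sum>k. A n k * F_hat_inv y k) \<in> Y)"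
    by (simp only: summable_F_hat_inv_iff C1_C2_iff)
  also have "\<dots> \<longleftrightarrow> (C1 A \<and> C2 A) \<and> d_lim A \<in> matrix_class c0_space Y"
  proof (rule conj_cong[OF refl])
    assume "C1 A \<and> C2 A"
    then have "\<And>n. d_trunc A n \<in> matrix_class c0_space c_space" by (simp add: C1_C2_iff)
    note lim = suminf_F_hat_inv[OF this]
    show "(\<forall>y\<in>c0_space. (\<lambda>n. \<Sum>k. A n k * F_hat_inv y k) \<in> Y) \<longleftrightarrow>
        d_lim A \<in> matrix_class c0_space Y"
      using lim unfolding matrix_class_c0_iff by (simp add: c0_space_def)
  qed
  finally show ?thesis by simp
qed

lemma C3_iff: "C3 A \<longleftrightarrow> bounded_rows (d_lim A)"
  by (simp add: C3_def bounded_rows_def)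

lemma C5_iff: "C5 A \<longleftrightarrow> d_lim A \<in> matrix_class c0_space l1_space"
  unfolding C5_def matrix_class_c0_l1 bdd_above_def by auto

lemma C4_alpha_zero_iff: "C4 A \<and> (\<forall>k. alpha A k = 0) \<longleftrightarrow> (\<forall>k. (\<lambda>n. d_lim A n k) \<longlonglongrightarrow> 0)"
  unfolding C4_def alpha_def
  by (metis convergentI convergent_LIMSEQ_iff limI)

text \<open>
  Each row of \<open>A\<close> is a difference of two rows of \<open>A_Sigma A\<close>, so the series for all rows of one
  matrix converge exactly if those for all rows of the other do, and the values for \<open>A_Sigma A\<close> are
  the partial sums of those for \<open>A\<close>.
\<close>

lemma matrix_class_A_Sigma:
  "A \<in> matrix_class X {x. (\<lambda>n. \<Sum>k\<le>n. x k) \<in> Y} \<longleftrightarrow> A_Sigma A \<in> matrix_class X Y"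
proof -
  have "(\<forall>n. summable (\<lambda>k. A n k * x k)) \<longleftrightarrow> (\<forall>n. summable (\<lambda>k. A_Sigma A n k * x k))" for x
  proof safe
    assume "\<forall>n. summable (\<lambda>k. A n k * x k)"
    then show "summable (\<lambda>k. A_Sigma A n k * x k)" for n
      by (auto simp: A_Sigma_def sum_distrib_right intro!: summable_sum)
  next
    fix n assume S: "\<forall>n. summable (\<lambda>k. A_Sigma A n k * x k)"
    show "summable (\<lambda>k. A n k * x k)"
    proof (cases n)
      case 0
      with S[rule_format, of 0] show ?thesis by (simp add: A_Sigma_def)
    next
      case (Suc m)
      have "A n k * x k = A_Sigma A (Suc m) k * x k - A_Sigma A m k * x k" for k
        by (simp add: A_Sigma_def Suc algebra_simps)
      with S show ?thesis by (simp add: summable_diff)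
    qed
  qed
  moreover have "(\<lambda>n. \<Sum>j\<le>n. \<Sum>k. A j k * x k) = (\<lambda>n. \<Sum>k. A_Sigma A n k * x k)"
    if "\<forall>n. summable (\<lambda>k. A n k * x k)" for x
    using that by (simp add: A_Sigma_def sum_distrib_right suminf_sum)
  ultimately show ?thesis unfolding matrix_class_def by auto
qed

text \<open>
  Here the rows of \<open>A\<close> are recovered from those of \<open>A_Delta A\<close> by summation, hence the induction on
  the row.
\<close>

lemma matrix_class_A_Delta:
  "A \<in> matrix_class X {x. (\<lambda>n. x n - (if n = 0 then 0 else x (n - 1))) \<in> Y} \<longleftrightarrow>
     A_Delta A \<in> matrix_class X Y"
proof -
  have step: "A_Delta A n k * x k = A n k * x k - (if n = 0 then 0 else A (n - 1) k * x k)" for n k x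
    by (simp add: A_Delta_def left_diff_distrib)
  have "(\<forall>n. summable (\<lambda>k. A n k * x k)) \<longleftrightarrow> (\<forall>n. summable (\<lambda>k. A_Delta A n k * x k))" for x
  proof safe
    assume "\<forall>n. summable (\<lambda>k. A n k * x k)"
    then show "summable (\<lambda>k. A_Delta A n k * x k)" for n
      by (cases n) (simp_all add: step summable_diff)
  next
    fix n assume S: "\<forall>n. summable (\<lambda>k. A_Delta A n k * x k)"
    show "summable (\<lambda>k. A n k * x k)"
    proof (induction n)
      case 0
      with S[rule_format, of 0] show ?case by (simp add: step)
    next
      case (Suc m)
      from summable_add[OF S[rule_format, of "Suc m"] this] show ?case by (simp add: step)
    qed
  qed
  moreover have "(\<lambda>n. (\<Sum>k. A n k * x k) - (if n = 0 then 0 else \<Sum>k. A (n - 1) k * x k))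
      = (\<lambda>n. \<Sum>k. A_Delta A n k * x k)"
    if "\<forall>n. summable (\<lambda>k. A n k * x k)" for x
    using that by (auto simp: step suminf_diff fun_eq_iff)
  ultimately show ?thesis unfolding matrix_class_def by auto
qed

section \<open>The classes of matrices on the Fibonacci null sequence space\<close>

lemma matrix_class_c0_F_hat_c0:
  "A \<in> matrix_class c0_F_hat c0_space \<longleftrightarrow> C1 A \<and> C2 A \<and> C3 A \<and> C4 A \<and> (\<forall>k. alpha A k = 0)"
  by (simp add: matrix_class_c0_F_hat_iff matrix_class_c0_c0 C3_iff C4_alpha_zero_iff)

lemma matrix_class_c0_F_hat_c:
  "A \<in> matrix_class c0_F_hat c_space \<longleftrightarrow> C1 A \<and> C2 A \<and> C3 A \<and> C4 A"
  by (simp add: matrix_class_c0_F_hat_iff matrix_class_c0_c C3_iff C4_def)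

lemma matrix_class_c0_F_hat_linf:
  "A \<in> matrix_class c0_F_hat linf_space \<longleftrightarrow> C1 A \<and> C2 A \<and> C3 A"
  by (simp add: matrix_class_c0_F_hat_iff matrix_class_c0_linf C3_iff)

lemma matrix_class_c0_F_hat_l1:
  "A \<in> matrix_class c0_F_hat l1_space \<longleftrightarrow> C1 A \<and> C2 A \<and> C5 A"
  by (simp add: matrix_class_c0_F_hat_iff C5_iff)

lemma bv1_space_eq: "bv1_space = {x. (\<lambda>n. x n - (if n = 0 then 0 else x (n - 1))) \<in> l1_space}"
  by (simp add: bv1_space_def l1_space_def)

theorem corollary4p8:
  fixes A :: "nat \<Rightarrow> nat \<Rightarrow> real"
  shows
    "(A \<in> matrix_class c0_F_hat c0_space \<longleftrightarrow>
        C1 A \<and> C2 A \<and> C3 A \<and> C4 A \<and> (\<forall>k. alpha A k = 0)) \<and>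
     (A \<in> matrix_class c0_F_hat cs0_space \<longleftrightarrow>
        C1 (A_Sigma A) \<and> C2 (A_Sigma A) \<and> C3 (A_Sigma A) \<and> C4 (A_Sigma A) \<and>
        (\<forall>k. alpha (A_Sigma A) k = 0)) \<and>
     (A \<in> matrix_class c0_F_hat c_space \<longleftrightarrow> C1 A \<and> C2 A \<and> C3 A \<and> C4 A) \<and>
     (A \<in> matrix_class c0_F_hat cs_space \<longleftrightarrow>
        C1 (A_Sigma A) \<and> C2 (A_Sigma A) \<and> C3 (A_Sigma A) \<and> C4 (A_Sigma A)) \<and>
     (A \<in> matrix_class c0_F_hat linf_space \<longleftrightarrow> C1 A \<and> C2 A \<and> C3 A) \<and>
     (A \<in> matrix_class c0_F_hat bs_space \<longleftrightarrow>
        C1 (A_Sigma A) \<and> C2 (A_Sigma A) \<and> C3 (A_Sigma A)) \<and>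
     (A \<in> matrix_class c0_F_hat l1_space \<longleftrightarrow> C1 A \<and> C2 A \<and> C5 A) \<and>
     (A \<in> matrix_class c0_F_hat bv1_space \<longleftrightarrow>
        C1 (A_Delta A) \<and> C2 (A_Delta A) \<and> C5 (A_Delta A))"
  unfolding cs0_space_def cs_space_def bs_space_def bv1_space_eq
    matrix_class_A_Sigma matrix_class_A_Delta
    matrix_class_c0_F_hat_c0 matrix_class_c0_F_hat_c matrix_class_c0_F_hat_linf
    matrix_class_c0_F_hat_l1
  by simp

end
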